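(* (General weak duality.) Consider the problem (VFP) of the context with feasible set $K$, and its dual (VFD) with feasible set $K'$. Let $\kappa\in K$ and $(\alpha,\beta,\lambda,\zeta)\in K'$ with $E(\lambda)=\lambda$. If $\sum_{i=1}^p\alpha_i(f_i-\zeta_ig_i)$ is a geodesic pseudo-semilocal E-preinvex (GpSLEP) function on $K_0$, $\sum_{j=1}^q\beta_jh_j$ is a geodesic quasi-semilocal E-preinvex (GqSLEP) function on $K_0$, and all these functions are geodesic E-$\eta$-semidifferentiable at $\lambda$, then $\frac{f(\kappa)}{g(\kappa)}\nleq\zeta$; that is, it is not the case that $\frac{f_i(\kappa)}{g_i(\kappa)}\le\zeta_i$ for all $i\in P$ with strict inequality for at least one $i$.
   Context: Setting: $\aleph$ is a Riemannian manifold, $E:\aleph\to\aleph$ is a map, and $\eta:\aleph\times\aleph\to T\aleph$ is a map with $\eta(x,y)\in T_y\aleph$. For points $\kappa_1,\kappa_2$, $\gamma_{E(\kappa_1),E(\kappa_2)}:[0,1]\to\aleph$ denotes the (unique) geodesic with $\gamma_{E(\kappa_1),E(\kappa_2)}(0)=E(\kappa_2)$ and initial velocity $\gamma'_{E(\kappa_1),E(\kappa_2)}(0)=\eta(E(\kappa_1),E(\kappa_2))$. GLEI set: a nonempty set $S\subset\aleph$ is geodesic local E-invex with respect to $\eta$ if for all $\kappa_1,\kappa_2\in S$ the geodesic $\gamma_{E(\kappa_1),E(\kappa_2)}:[0,1]\to\aleph$ exists and there is $u(\kappa_1,\kappa_2)\in(0,1]$ such that $\gamma_{E(\kappa_1),E(\kappa_2)}(t)\in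 S$ for all $t\in[0,u(\kappa_1,\kappa_2)]$. GqSLEP function: $h:S\to\mathbb{R}$, $S$ a GLEI set, is geodesic quasi-semilocal E-preinvex if for all $\kappa_1,\kappa_2\in S$ with $h(\kappa_1)\le h(\kappa_2)$ there is a positive number $v(\kappa_1,\kappa_2)\le u(\kappa_1,\kappa_2)$ such that $h(\gamma_{E(\kappa_1),E(\kappa_2)}(t))\le h(\kappa_2)$ for all $t\in[0,v(\kappa_1,\kappa_2)]$. GpSLEP function: $h:S\to\mathbb{R}$, $S$ a GLEI set, is geodesic pseudo-semilocal E-preinvex if for all $\kappa_1,\kappa_2\in S$ with $h(\kappa_1)<h(\kappa_2)$ there are positive numbers $v(\kappa_1,\kappa_2)\le u(\kappa_1,\kappa_2)$ and $w(\kappa_1,\kappa_2)$ such that $h(\gamma_{E(\kappa_1),E(\kappa_2)}(t))\le h(\kappa_2)-t\,w(\kappa_1,\kappa_2)$ for all $t\in[0,v(\kappa_1,\kappa_2)]$. Semidifferentiability: $h:S\to\mathbb{R}$ on a GLEI set $S$ is geodesic E-$\eta$-semidifferentiable at $\kappa^*\in S$ if $E(\kappa^* )=\kappa^*$ and for every $\kappa\in S$ the limit $$h'_+(\kappa^*;\kappa)=\lim_{t\to0^+}\frac1t\Big[h\big(\gamma_{E(\kappa),\kappa^*}(t)\big)-h(\kappa^* )\Big]$$ exists in $\mathbb{R}$, where $\gamma_{E(\kappa),\kappa^*}=\gamma_{E(\kappa),E(\kappa^* )}$ is the geodesic starting at $\kappa^*$ with initial velocity $\eta(E(\kappa),\kappa^*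 )$. Problem (VFP): $K_0\subset\aleph$ is a GLEI set, $P=\{1,\dots,p\}$, $Q=\{1,\dots,q\}$, $f_i,g_i,h_j:K_0\to\mathbb{R}$ for $i\in P,j\in Q$, with $g_i>0$ on $K_0$. Minimize $\frac{f(\kappa)}{g(\kappa)}=\left(\frac{f_1(\kappa)}{g_1(\kappa)},\dots,\frac{f_p(\kappa)}{g_p(\kappa)}\right)$ subject to $h_j(\kappa)\le0$ $(j\in Q)$, $\kappa\in K_0$. The feasible set is $K=\{\kappa\in K_0:h_j(\kappa)\le0,\ j\in Q\}$. Dual problem (VFD), with objective vector $\zeta=(\zeta_1,\dots,\zeta_p)$: its feasible set $K'$ consists of all $(\alpha,\beta,\lambda,\zeta)$ with $\alpha\in\mathbb{R}^p$, $\alpha_i>0$ for all $i$; $\beta\in\mathbb{R}^q$, $\beta_j\ge0$ for all $j$; $\zeta\in\mathbb{R}^p$, $\zeta_i\ge0$ for all $i$; $\lambda\in K_0$; such that the individual one-sided derivatives $f'_{i+}(\lambda;\kappa),g'_{i+}(\lambda;\kappa),h'_{j+}(\lambda;\kappa)$ exist and $$\sum_{i=1}^p\alpha_i\big(f'_{i+}(\lambda;\kappa)-\zeta_i\,g'_{i+}(\lambda;\kappa)\big)+\sum_{j=1}^q\beta_jh'_{j+}(\lambda;\kappa)\ge0\quad\text{for all }\kappa\in K_0,$$ $f_i(\lambda)-\zeta_ig_i(\lambda)\ge0$ for all $i\in P$, and $\beta_jh_j(\lambda)\ge0$ for all $j\in Q$. *)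

theory Defs
  imports "HOL-Analysis.Analysis"
begin

section \<open>Smooth maps between Euclidean spaces\<close>

text \<open>The following notions are meant for open sets \<open>S\<close>. Since the spaces are
  finite-dimensional, continuity of all directional derivatives is the same as continuity of the
  total derivative.\<close>

primrec Ck_on ::
  "nat \<Rightarrow> ('e::euclidean_space \<Rightarrow> 'f::real_normed_vector) \<Rightarrow> 'e set \<Rightarrow> bool" where
  "Ck_on 0 f S \<longleftrightarrow> continuous_on S f"
| "Ck_on (Suc k) f S \<longleftrightarrow> (\<forall>x\<in>S. f differentiable (at x)) \<and>
     (\<forall>v. Ck_on k (\<lambda>x. frechet_derivative f (at x) v) S)"

definition smooth_on :: "'e set \<Rightarrow> ('e::euclidean_space \<Rightarrow> 'f::real_normed_vector) \<Rightarrow> bool" where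
  "smooth_on S f \<longleftrightarrow> (\<forall>k. Ck_on k f S)"

section \<open>Riemannian manifolds\<close>

text \<open>The manifold is the whole (Hausdorff, second countable) type \<^typ>\<open>'a\<close>. A chart is a pair
  \<open>(U, \<phi>)\<close>; values of \<open>\<phi>\<close> outside \<open>U\<close> are irrelevant.\<close>

type_synonym ('a, 'n) atlas = "('a set \<times> ('a \<Rightarrow> (real, 'n) vec)) set"

text \<open>Tangent vectors are derivations of the algebra of smooth functions.\<close>

type_synonym 'a tangent = "('a \<Rightarrow> real) \<Rightarrow> real"
type_synonym 'a metric = "'a \<Rightarrow> 'a tangent \<Rightarrow> 'a tangent \<Rightarrow> real"

definition smooth_atlas ::
  "('a::{t2_space, second_countable_topology}, 'n::finite) atlas \<Rightarrow> bool" where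
  "smooth_atlas A \<longleftrightarrow>
     (\<Union>(U, \<phi>)\<in>A. U) = UNIV \<and>
     (\<forall>(U, \<phi>)\<in>A. open U \<and> open (\<phi> ` U) \<and> homeomorphism U (\<phi> ` U) \<phi> (inv_into U \<phi>)) \<and>
     (\<forall>(U, \<phi>)\<in>A. \<forall>(V, \<psi>)\<in>A. smooth_on (\<phi> ` (U \<inter> V)) (\<psi> \<circ> inv_into U \<phi>))"

definition smooth_fun :: "('a, 'n::finite) atlas \<Rightarrow> ('a \<Rightarrow> real) \<Rightarrow> bool" where
  "smooth_fun A F \<longleftrightarrow> (\<forall>(U, \<phi>)\<in>A. smooth_on (\<phi> ` U) (F \<circ> inv_into U \<phi>))"

text \<open>The value of a derivation on non-smooth functions is normalised to 0, so that equal tangent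
  vectors are equal as HOL functions.\<close>

definition tangent_space :: "('a, 'n::finite) atlas \<Rightarrow> 'a \<Rightarrow> 'a tangent set" where
  "tangent_space A y = {X.
     (\<forall>F. \<not> smooth_fun A F \<longrightarrow> X F = 0) \<and>
     (\<forall>F G a b. smooth_fun A F \<longrightarrow> smooth_fun A G \<longrightarrow>
        X (\<lambda>z. a * F z + b * G z) = a * X F + b * X G) \<and>
     (\<forall>F G. smooth_fun A F \<longrightarrow> smooth_fun A G \<longrightarrow>
        X (\<lambda>z. F z * G z) = F y * X G + G y * X F)}"

definition partial_deriv :: "'n::finite \<Rightarrow> (real ^ 'n \<Rightarrow> real) \<Rightarrow> real ^ 'n \<Rightarrow> real" where
  "partial_deriv i F x = frechet_derivative F (at x) (axis i 1)"

definition coord_vector ::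
  "('a, 'n::finite) atlas \<Rightarrow> 'a set \<Rightarrow> ('a \<Rightarrow> real ^ 'n) \<Rightarrow> 'n \<Rightarrow> 'a \<Rightarrow> 'a tangent" where
  "coord_vector A U \<phi> i y =
     (\<lambda>F. if smooth_fun A F then partial_deriv i (F \<circ> inv_into U \<phi>) (\<phi> y) else 0)"

text \<open>The Gram matrix of the metric in a chart, as a function of the coordinates \<open>x \<in> \<phi> ` U\<close>.\<close>

definition metric_matrix ::
  "('a, 'n::finite) atlas \<Rightarrow> 'a metric \<Rightarrow> 'a set \<Rightarrow> ('a \<Rightarrow> real ^ 'n) \<Rightarrow> real ^ 'n \<Rightarrow> real ^ 'n ^ 'n"
  where
  "metric_matrix A met U \<phi> x = (let y = inv_into U \<phi> x in
     (\<chi> i j. met y (coord_vector A U \<phi> i y) (coord_vector A U \<phi> j y)))"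

definition riemannian_manifold ::
  "('a::{t2_space, second_countable_topology}, 'n::finite) atlas \<Rightarrow> 'a metric \<Rightarrow> bool" where
  "riemannian_manifold A met \<longleftrightarrow>
     smooth_atlas A \<and>
     (\<forall>y. \<forall>X\<in>tangent_space A y. \<forall>Y\<in>tangent_space A y. met y X Y = met y Y X) \<and>
     (\<forall>y. \<forall>X\<in>tangent_space A y. \<forall>Y\<in>tangent_space A y. \<forall>Z\<in>tangent_space A y. \<forall>a b.
        met y (\<lambda>F. a * X F + b * Y F) Z = a * met y X Z + b * met y Y Z) \<and>
     (\<forall>y. \<forall>X\<in>tangent_space A y. X \<noteq> (\<lambda>F. 0) \<longrightarrow> met y X X > 0) \<and>
     (\<forall>(U, \<phi>)\<in>A. \<forall>i j. smooth_on (\<phi> ` U) (\<lambda>x. metric_matrix A met U \<phi> x $ i $ j))"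

section \<open>Geodesics\<close>

text \<open>\<open>\<Gamma>\<^sup>k\<^sub>i\<^sub>j = 1/2 \<Sum>\<^sub>l g\<^sup>k\<^sup>l (\<partial>\<^sub>i g\<^sub>j\<^sub>l + \<partial>\<^sub>j g\<^sub>i\<^sub>l - \<partial>\<^sub>l g\<^sub>i\<^sub>j)\<close> for the Levi-Civita connection.\<close>

definition christoffel ::
  "('a, 'n::finite) atlas \<Rightarrow> 'a metric \<Rightarrow> 'a set \<Rightarrow> ('a \<Rightarrow> real ^ 'n) \<Rightarrow>
   'n \<Rightarrow> 'n \<Rightarrow> 'n \<Rightarrow> real ^ 'n \<Rightarrow> real" where
  "christoffel A met U \<phi> k i j x = (let G = metric_matrix A met U \<phi> in
     1 / 2 * (\<Sum>l\<in>UNIV. matrix_inv (G x) $ k $ l *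
       (partial_deriv i (\<lambda>z. G z $ j $ l) x + partial_deriv j (\<lambda>z. G z $ i $ l) x
        - partial_deriv l (\<lambda>z. G z $ i $ j) x)))"

text \<open>The functions \<open>x'\<close>, \<open>x''\<close> are the first two derivatives of the coordinate curve \<open>\<phi> \<circ> c\<close>. They
  are constrained only on the relatively open set of parameters where \<open>c\<close> runs in \<open>U\<close>;
  derivatives at the end points of \<open>[0, 1]\<close> are one-sided.\<close>

definition geodesic_on_unit ::
  "('a::topological_space, 'n::finite) atlas \<Rightarrow> 'a metric \<Rightarrow> (real \<Rightarrow> 'a) \<Rightarrow> bool" where
  "geodesic_on_unit A met c \<longleftrightarrow> continuous_on {0..1} c \<and>
     (\<forall>(U, \<phi>)\<in>A. \<exists>x' x''. \<forall>t\<in>{0..1}. c t \<in> U \<longrightarrow>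
        ((\<phi> \<circ> c) has_vector_derivative x' t) (at t within {0..1}) \<and>
        (x' has_vector_derivative x'' t) (at t within {0..1}) \<and>
        (\<forall>k. x'' t $ k + (\<Sum>i\<in>UNIV. \<Sum>j\<in>UNIV.
           christoffel A met U \<phi> k i j (\<phi> (c t)) * x' t $ i * x' t $ j) = 0))"

definition initial_velocity ::
  "('a, 'n::finite) atlas \<Rightarrow> (real \<Rightarrow> 'a) \<Rightarrow> 'a tangent \<Rightarrow> bool" where
  "initial_velocity A c X \<longleftrightarrow>
     (\<forall>F. smooth_fun A F \<longrightarrow> ((\<lambda>t. F (c t)) has_real_derivative X F) (at 0 within {0..1}))"

text \<open>\<open>is_eta_geodesic A met \<eta> x y c\<close>: \<open>c\<close> is a geodesic on \<open>[0, 1]\<close> starting at \<open>y\<close> (the \<^emph>\<open>second\<close> point)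
  with velocity \<open>\<eta> x y\<close>, a tangent vector at \<open>y\<close>. Extensionality makes such a curve unique as a
  HOL function, so the definite description below denotes it whenever it exists.\<close>

definition is_eta_geodesic ::
  "('a::topological_space, 'n::finite) atlas \<Rightarrow> 'a metric \<Rightarrow> ('a \<Rightarrow> 'a \<Rightarrow> 'a tangent) \<Rightarrow>
   'a \<Rightarrow> 'a \<Rightarrow> (real \<Rightarrow> 'a) \<Rightarrow> bool" where
  "is_eta_geodesic A met \<eta> x y c \<longleftrightarrow> c \<in> extensional {0..1} \<and>
     geodesic_on_unit A met c \<and> c 0 = y \<and> initial_velocity A c (\<eta> x y)"

definition eta_geodesic ::
  "('a::topological_space, 'n::finite) atlas \<Rightarrow> 'a metric \<Rightarrow> ('a \<Rightarrow> 'a \<Rightarrow> 'a tangent) \<Rightarrow>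
   'a \<Rightarrow> 'a \<Rightarrow> real \<Rightarrow> 'a" where
  "eta_geodesic A met \<eta> x y = (THE c. is_eta_geodesic A met \<eta> x y c)"

section \<open>Geodesic local E-invexity and generalised preinvexity\<close>

text \<open>\<open>u\<close> is a choice of the bounds \<open>u(\<kappa>\<^sub>1, \<kappa>\<^sub>2)\<close> witnessing that \<open>S\<close> is a geodesic local
  E-invex (GLEI) set.\<close>

definition glei_bound ::
  "('a::topological_space, 'n::finite) atlas \<Rightarrow> 'a metric \<Rightarrow> ('a \<Rightarrow> 'a \<Rightarrow> 'a tangent) \<Rightarrow>
   ('a \<Rightarrow> 'a) \<Rightarrow> 'a set \<Rightarrow> ('a \<Rightarrow> 'a \<Rightarrow> real) \<Rightarrow> bool" where
  "glei_bound A met \<eta> E S u \<longleftrightarrow> S \<noteq> {} \<and>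
     (\<forall>\<kappa>1\<in>S. \<forall>\<kappa>2\<in>S. (\<exists>c. is_eta_geodesic A met \<eta> (E \<kappa>1) (E \<kappa>2) c) \<and>
        0 < u \<kappa>1 \<kappa>2 \<and> u \<kappa>1 \<kappa>2 \<le> 1 \<and>
        (\<forall>t\<in>{0..u \<kappa>1 \<kappa>2}. eta_geodesic A met \<eta> (E \<kappa>1) (E \<kappa>2) t \<in> S))"

definition glei_set ::
  "('a::topological_space, 'n::finite) atlas \<Rightarrow> 'a metric \<Rightarrow> ('a \<Rightarrow> 'a \<Rightarrow> 'a tangent) \<Rightarrow>
   ('a \<Rightarrow> 'a) \<Rightarrow> 'a set \<Rightarrow> bool" where
  "glei_set A met \<eta> E S \<longleftrightarrow> (\<exists>u. glei_bound A met \<eta> E S u)"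

text \<open>In the following definitions \<open>h\<close> stands for a function \<open>S \<rightarrow> \<real>\<close>; only its values on \<open>S\<close> matter.
  GqSLEP and GpSLEP abbreviate geodesic quasi- and pseudo-semilocal E-preinvex. Since \<open>v\<close> may be
  decreased, these notions do not depend on the choice of \<open>u\<close>.\<close>

definition gqslep ::
  "('a::topological_space, 'n::finite) atlas \<Rightarrow> 'a metric \<Rightarrow> ('a \<Rightarrow> 'a \<Rightarrow> 'a tangent) \<Rightarrow>
   ('a \<Rightarrow> 'a) \<Rightarrow> 'a set \<Rightarrow> ('a \<Rightarrow> real) \<Rightarrow> bool" where
  "gqslep A met \<eta> E S h \<longleftrightarrow> (\<exists>u. glei_bound A met \<eta> E S u \<and>
     (\<forall>\<kappa>1\<in>S. \<forall>\<kappa>2\<in>S. h \<kappa>1 \<le> h \<kappa>2 \<longrightarrow>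
        (\<exists>v>0. v \<le> u \<kappa>1 \<kappa>2 \<and>
           (\<forall>t\<in>{0..v}. h (eta_geodesic A met \<eta> (E \<kappa>1) (E \<kappa>2) t) \<le> h \<kappa>2))))"

definition gpslep ::
  "('a::topological_space, 'n::finite) atlas \<Rightarrow> 'a metric \<Rightarrow> ('a \<Rightarrow> 'a \<Rightarrow> 'a tangent) \<Rightarrow>
   ('a \<Rightarrow> 'a) \<Rightarrow> 'a set \<Rightarrow> ('a \<Rightarrow> real) \<Rightarrow> bool" where
  "gpslep A met \<eta> E S h \<longleftrightarrow> (\<exists>u. glei_bound A met \<eta> E S u \<and>
     (\<forall>\<kappa>1\<in>S. \<forall>\<kappa>2\<in>S. h \<kappa>1 < h \<kappa>2 \<longrightarrow>
        (\<exists>v>0. \<exists>w>0. v \<le> u \<kappa>1 \<kappa>2 \<and>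
           (\<forall>t\<in>{0..v}. h (eta_geodesic A met \<eta> (E \<kappa>1) (E \<kappa>2) t) \<le> h \<kappa>2 - t * w))))"

text \<open>\<open>has_semideriv A met \<eta> E S h \<kappa>s \<kappa> D\<close>: the limit \<open>h'\<^sub>+(\<kappa>s; \<kappa>)\<close> exists and equals \<open>D\<close>. For the limit to
  make sense for a function defined on \<open>S\<close> only, the geodesic has to exist and to stay in \<open>S\<close> for
  small \<open>t > 0\<close>; on a GLEI set \<open>S\<close> both are automatic if \<open>E \<kappa>s = \<kappa>s\<close> and \<open>\<kappa>, \<kappa>s \<in> S\<close>.\<close>

definition has_semideriv ::
  "('a::topological_space, 'n::finite) atlas \<Rightarrow> 'a metric \<Rightarrow> ('a \<Rightarrow> 'a \<Rightarrow> 'a tangent) \<Rightarrow>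
   ('a \<Rightarrow> 'a) \<Rightarrow> 'a set \<Rightarrow> ('a \<Rightarrow> real) \<Rightarrow> 'a \<Rightarrow> 'a \<Rightarrow> real \<Rightarrow> bool" where
  "has_semideriv A met \<eta> E S h \<kappa>s \<kappa> D \<longleftrightarrow>
     (\<exists>c. is_eta_geodesic A met \<eta> (E \<kappa>) \<kappa>s c) \<and>
     (\<forall>\<^sub>F t in at_right 0. eta_geodesic A met \<eta> (E \<kappa>) \<kappa>s t \<in> S) \<and>
     ((\<lambda>t. 1 / t * (h (eta_geodesic A met \<eta> (E \<kappa>) \<kappa>s t) - h \<kappa>s)) \<longlongrightarrow> D) (at_right 0)"

definition semideriv ::
  "('a::topological_space, 'n::finite) atlas \<Rightarrow> 'a metric \<Rightarrow> ('a \<Rightarrow> 'a \<Rightarrow> 'a tangent) \<Rightarrow>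
   ('a \<Rightarrow> 'a) \<Rightarrow> 'a set \<Rightarrow> ('a \<Rightarrow> real) \<Rightarrow> 'a \<Rightarrow> 'a \<Rightarrow> real" where
  "semideriv A met \<eta> E S h \<kappa>s \<kappa> = (THE D. has_semideriv A met \<eta> E S h \<kappa>s \<kappa> D)"

definition semidifferentiable ::
  "('a::topological_space, 'n::finite) atlas \<Rightarrow> 'a metric \<Rightarrow> ('a \<Rightarrow> 'a \<Rightarrow> 'a tangent) \<Rightarrow>
   ('a \<Rightarrow> 'a) \<Rightarrow> 'a set \<Rightarrow> ('a \<Rightarrow> real) \<Rightarrow> 'a \<Rightarrow> bool" where
  "semidifferentiable A met \<eta> E S h \<kappa>s \<longleftrightarrow> glei_set A met \<eta> E S \<and> \<kappa>s \<in> S \<and> E \<kappa>s = \<kappa>s \<and>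
     (\<forall>\<kappa>\<in>S. \<exists>D. has_semideriv A met \<eta> E S h \<kappa>s \<kappa> D)"

section \<open>The fractional problem and its dual\<close>

text \<open>Families and vectors indexed by \<open>{1..p}\<close> and \<open>{1..q}\<close> are functions on \<^typ>\<open>nat\<close>; only the
  values at these indices matter.\<close>

definition vfp_feasible :: "nat \<Rightarrow> (nat \<Rightarrow> 'a \<Rightarrow> real) \<Rightarrow> 'a set \<Rightarrow> 'a set" where
  "vfp_feasible q h K0 = {\<kappa>\<in>K0. \<forall>j\<in>{1..q}. h j \<kappa> \<le> 0}"

definition vfd_feasible ::
  "('a::topological_space, 'n::finite) atlas \<Rightarrow> 'a metric \<Rightarrow> ('a \<Rightarrow> 'a \<Rightarrow> 'a tangent) \<Rightarrow>
   ('a \<Rightarrow> 'a) \<Rightarrow> nat \<Rightarrow> nat \<Rightarrow> (nat \<Rightarrow> 'a \<Rightarrow> real) \<Rightarrow> (nat \<Rightarrow> 'a \<Rightarrow> real) \<Rightarrow> (nat \<Rightarrow> 'a \<Rightarrow> real) \<Rightarrow>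
   'a set \<Rightarrow> ((nat \<Rightarrow> real) \<times> (nat \<Rightarrow> real) \<times> 'a \<times> (nat \<Rightarrow> real)) set" where
  "vfd_feasible A met \<eta> E p q f g h K0 = {(\<alpha>, \<beta>, lam, \<zeta>).
     (\<forall>i\<in>{1..p}. 0 < \<alpha> i) \<and> (\<forall>j\<in>{1..q}. 0 \<le> \<beta> j) \<and> (\<forall>i\<in>{1..p}. 0 \<le> \<zeta> i) \<and> lam \<in> K0 \<and>
     (\<forall>\<kappa>\<in>K0.
        (\<forall>i\<in>{1..p}. \<exists>D. has_semideriv A met \<eta> E K0 (f i) lam \<kappa> D) \<and>
        (\<forall>i\<in>{1..p}. \<exists>D. has_semideriv A met \<eta> E K0 (g i) lam \<kappa> D) \<and>
        (\<forall>j\<in>{1..q}. \<exists>D. has_semideriv A met \<eta> E K0 (h j) lam \<kappa> D) \<and>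
        (\<Sum>i=1..p. \<alpha> i * (semideriv A met \<eta> E K0 (f i) lam \<kappa>
             - \<zeta> i * semideriv A met \<eta> E K0 (g i) lam \<kappa>))
          + (\<Sum>j=1..q. \<beta> j * semideriv A met \<eta> E K0 (h j) lam \<kappa>) \<ge> 0) \<and>
     (\<forall>i\<in>{1..p}. f i lam - \<zeta> i * g i lam \<ge> 0) \<and>
     (\<forall>j\<in>{1..q}. \<beta> j * h j lam \<ge> 0)}"

end

theory Submission imports Defs begin

text \<open>If \<open>\<kappa>\<close> violated weak duality, then \<open>F = \<Sum> \<alpha>\<^sub>i (f\<^sub>i - \<zeta>\<^sub>i g\<^sub>i)\<close> would satisfy
  \<open>F \<kappa> < 0 \<le> F \<lambda>\<close>, while \<open>H = \<Sum> \<beta>\<^sub>j h\<^sub>j\<close> satisfies \<open>H \<kappa> \<le> 0 \<le> H \<lambda>\<close>. Pseudo-preinvexity bounds the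
  difference quotients of \<open>F\<close> along the geodesic from \<open>\<lambda>\<close> by some \<open>- w < 0\<close>, and
  quasi-preinvexity bounds those of \<open>H\<close> by \<open>0\<close>. Hence \<open>F'\<^sub>+(\<lambda>; \<kappa>) + H'\<^sub>+(\<lambda>; \<kappa>) < 0\<close>, which by
  linearity of the semiderivative contradicts dual feasibility.\<close>

text \<open>The filter \<open>at_right 0\<close> is nontrivial, so a limit along it is unique; this
  gives the definite description in \<open>semideriv\<close> its meaning.\<close>

lemma has_semideriv_unique:
  assumes "has_semideriv A met \<eta> E S h y x D" and "has_semideriv A met \<eta> E S h y x D'"
  shows "D = D'"
  using assms unfolding has_semideriv_def
  by (blast intro: tendsto_unique[OF trivial_limit_at_right_real])

lemma semideriv_eqI:
  assumes "has_semideriv A met \<eta> E S h y x D"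
  shows "semideriv A met \<eta> E S h y x = D"
  unfolding semideriv_def
  using assms has_semideriv_unique[OF _ assms] by (rule the_equality)

lemma has_semideriv_diff_cmult:
  assumes "has_semideriv A met \<eta> E S f y x D" and "has_semideriv A met \<eta> E S g y x D'"
  shows "has_semideriv A met \<eta> E S (\<lambda>z. f z - c * g z) y x (D - c * D')"
proof -
  let ?\<gamma> = "eta_geodesic A met \<eta> (E x) y"
  have "((\<lambda>t. 1 / t * (f (?\<gamma> t) - f y) - c * (1 / t * (g (?\<gamma> t) - g y))) \<longlongrightarrow> D - c * D')
      (at_right 0)"
    using assms unfolding has_semideriv_def by (intro tendsto_intros) auto
  moreover have "(\<lambda>t. 1 / t * (f (?\<gamma> t) - f y) - c * (1 / t * (g (?\<gamma> t) - g y))) =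
      (\<lambda>t. 1 / t * ((f (?\<gamma> t) - c * g (?\<gamma> t)) - (f y - c * g y)))"
    by (simp add: fun_eq_iff algebra_simps)
  ultimately show ?thesis
    using assms unfolding has_semideriv_def by simp
qed

text \<open>Semidifferentiability of the sum is assumed because an empty family would say nothing about
  the existence of the geodesic.\<close>

lemma semideriv_weighted_sum:
  assumes sum: "has_semideriv A met \<eta> E S (\<lambda>z. \<Sum>i\<in>I. c i * \<phi> i z) y x D"
    and parts: "\<And>i. i \<in> I \<Longrightarrow> has_semideriv A met \<eta> E S (\<phi> i) y x (D' i)"
  shows "D = (\<Sum>i\<in>I. c i * D' i)"
proof -
  let ?\<gamma> = "eta_geodesic A met \<eta> (E x) y"
  have "((\<lambda>t. \<Sum>i\<in>I. c i * (1 / t * (\<phi> i (?\<gamma> t) - \<phi> i y))) \<longlongrightarrow> (\<Sum>i\<in>I. c i * D' i)) (at_right 0)"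
    using parts unfolding has_semideriv_def by (intro tendsto_intros) auto
  moreover have "(\<lambda>t. \<Sum>i\<in>I. c i * (1 / t * (\<phi> i (?\<gamma> t) - \<phi> i y))) =
      (\<lambda>t. 1 / t * ((\<Sum>i\<in>I. c i * \<phi> i (?\<gamma> t)) - (\<Sum>i\<in>I. c i * \<phi> i y)))"
    by (simp add: fun_eq_iff sum_distrib_left right_diff_distrib sum_subtractf algebra_simps)
  ultimately have "((\<lambda>t. 1 / t * ((\<Sum>i\<in>I. c i * \<phi> i (?\<gamma> t)) - (\<Sum>i\<in>I. c i * \<phi> i y)))
      \<longlongrightarrow> (\<Sum>i\<in>I. c i * D' i)) (at_right 0)"
    by simp
  then show ?thesis
    using sum unfolding has_semideriv_def
    by (blast intro: tendsto_unique[OF trivial_limit_at_right_real])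
qed

text \<open>Dividing the bound by \<open>t > 0\<close> bounds the difference quotients by
  \<open>- w\<close> on \<open>0 < t < v\<close>, and weak inequalities survive the limit.
  Pseudo-preinvexity supplies \<open>w > 0\<close>; quasi-preinvexity is the case
  \<open>w = 0\<close>.\<close>

lemma has_semideriv_le:
  assumes deriv: "has_semideriv A met \<eta> E S h y x D" and "v > 0"
    and bound: "\<And>t. t \<in> {0..v} \<Longrightarrow> h (eta_geodesic A met \<eta> (E x) y t) \<le> h y - t * w"
  shows "D \<le> - w"
proof (rule tendsto_upperbound)
  let ?\<gamma> = "eta_geodesic A met \<eta> (E x) y"
  show "((\<lambda>t. 1 / t * (h (?\<gamma> t) - h y)) \<longlongrightarrow> D) (at_right 0)"
    using deriv unfolding has_semideriv_def by blast
  have "1 / t * (h (?\<gamma> t) - h y) \<le> - w" if "0 < t" "t < v" for t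
    using bound[of t] that by (simp add: pos_divide_le_eq mult.commute)
  then show "\<forall>\<^sub>F t in at_right 0. 1 / t * (h (?\<gamma> t) - h y) \<le> - w"
    using \<open>v > 0\<close> unfolding eventually_at_right_field by blast
qed simp

text \<open>The fixed point condition \<open>E y = y\<close> identifies the geodesic of preinvexity,
  which starts at \<open>E y\<close>, with the one defining the semiderivative. Strictness survives
  the limit because the rate \<open>w\<close> is independent of \<open>t\<close>.\<close>

lemma gpslep_semideriv_neg:
  assumes "gpslep A met \<eta> E S h" and "x \<in> S" and "y \<in> S" and "E y = y" and "h x < h y"
    and deriv: "has_semideriv A met \<eta> E S h y x D"
  shows "D < 0"
proof -
  obtain v w where "v > 0" "w > 0"
    "\<forall>t\<in>{0..v}. h (eta_geodesic A met \<eta> (E x) y t) \<le> h y - t * w"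
    using assms unfolding gpslep_def by metis
  then show ?thesis
    using has_semideriv_le[OF deriv, of v w] by fastforce
qed

lemma gqslep_semideriv_nonpos:
  assumes "gqslep A met \<eta> E S h" and "x \<in> S" and "y \<in> S" and "E y = y" and "h x \<le> h y"
    and deriv: "has_semideriv A met \<eta> E S h y x D"
  shows "D \<le> 0"
proof -
  obtain v where "v > 0" "\<forall>t\<in>{0..v}. h (eta_geodesic A met \<eta> (E x) y t) \<le> h y"
    using assms unfolding gqslep_def by metis
  then show ?thesis
    using has_semideriv_le[OF deriv, of v 0] by fastforce
qed

theorem theorem3p7:
  fixes A :: "('a::{t2_space, second_countable_topology}, 'n::finite) atlas"
    and met :: "'a metric"
    and \<eta> :: "'a \<Rightarrow> 'a \<Rightarrow> 'a tangent"
    and E :: "'a \<Rightarrow> 'a"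
    and p q :: nat
    and f g h :: "nat \<Rightarrow> 'a \<Rightarrow> real"
    and K0 :: "'a set"
    and \<alpha> \<beta> \<zeta> :: "nat \<Rightarrow> real"
    and \<kappa> lam :: 'a
  assumes "riemannian_manifold A met"
    and "\<And>x y. \<eta> x y \<in> tangent_space A y"
    and "glei_set A met \<eta> E K0"
    and "\<And>i x. i \<in> {1..p} \<Longrightarrow> x \<in> K0 \<Longrightarrow> g i x > 0"
    and "\<kappa> \<in> vfp_feasible q h K0"
    and "(\<alpha>, \<beta>, lam, \<zeta>) \<in> vfd_feasible A met \<eta> E p q f g h K0"
    and "E lam = lam"
    and "gpslep A met \<eta> E K0 (\<lambda>x. \<Sum>i=1..p. \<alpha> i * (f i x - \<zeta> i * g i x))"
    and "gqslep A met \<eta> E K0 (\<lambda>x. \<Sum>j=1..q. \<beta> j * h j x)"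
    and "\<And>i. i \<in> {1..p} \<Longrightarrow> semidifferentiable A met \<eta> E K0 (f i) lam"
    and "\<And>i. i \<in> {1..p} \<Longrightarrow> semidifferentiable A met \<eta> E K0 (g i) lam"
    and "\<And>j. j \<in> {1..q} \<Longrightarrow> semidifferentiable A met \<eta> E K0 (h j) lam"
    and "semidifferentiable A met \<eta> E K0 (\<lambda>x. \<Sum>i=1..p. \<alpha> i * (f i x - \<zeta> i * g i x)) lam"
    and "semidifferentiable A met \<eta> E K0 (\<lambda>x. \<Sum>j=1..q. \<beta> j * h j x) lam"
  shows "\<not> ((\<forall>i\<in>{1..p}. f i \<kappa> / g i \<kappa> \<le> \<zeta> i) \<and> (\<exists>i\<in>{1..p}. f i \<kappa> / g i \<kappa> < \<zeta> i))"
proof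
  assume le: "(\<forall>i\<in>{1..p}. f i \<kappa> / g i \<kappa> \<le> \<zeta> i) \<and> (\<exists>i\<in>{1..p}. f i \<kappa> / g i \<kappa> < \<zeta> i)"
  let ?F = "\<lambda>x. \<Sum>i=1..p. \<alpha> i * (f i x - \<zeta> i * g i x)"
  let ?H = "\<lambda>x. \<Sum>j=1..q. \<beta> j * h j x"
  let ?d = "\<lambda>\<phi>. semideriv A met \<eta> E K0 \<phi> lam \<kappa>"
  have \<kappa>: "\<kappa> \<in> K0" "\<And>j. j \<in> {1..q} \<Longrightarrow> h j \<kappa> \<le> 0"
    using assms(5) by (auto simp: vfp_feasible_def)
  have lam: "lam \<in> K0"
    and \<alpha>: "\<And>i. i \<in> {1..p} \<Longrightarrow> 0 < \<alpha> i" and \<beta>: "\<And>j. j \<in> {1..q} \<Longrightarrow> 0 \<le> \<beta> j"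
    and F_lam: "\<And>i. i \<in> {1..p} \<Longrightarrow> 0 \<le> f i lam - \<zeta> i * g i lam"
    and H_lam: "\<And>j. j \<in> {1..q} \<Longrightarrow> 0 \<le> \<beta> j * h j lam"
    and dual: "0 \<le> (\<Sum>i=1..p. \<alpha> i * (?d (f i) - \<zeta> i * ?d (g i))) + (\<Sum>j=1..q. \<beta> j * ?d (h j))"
    using assms(6) \<kappa>(1) by (auto simp: vfd_feasible_def)
  have has_d: "has_semideriv A met \<eta> E K0 \<phi> lam \<kappa> (?d \<phi>)"
    if "semidifferentiable A met \<eta> E K0 \<phi> lam" for \<phi>
    using that \<kappa>(1) semideriv_eqI unfolding semidifferentiable_def by metis

  \<comment> \<open>Positivity of \<open>g i \<kappa>\<close> clears the denominators, and
    \<open>\<alpha> i > 0\<close> keeps the one strict inequality strict. Zero is written as a sum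
    so that the comparison is termwise.\<close>
  have "?F \<kappa> < (\<Sum>i=1..p. 0)"
  proof (rule sum_strict_mono_ex1)
    have "\<alpha> i * (f i \<kappa> - \<zeta> i * g i \<kappa>) \<le> 0" if "i \<in> {1..p}" for i
    proof -
      have "f i \<kappa> / g i \<kappa> \<le> \<zeta> i" using le that by blast
      then show ?thesis
        using \<alpha>[OF that] assms(4)[OF that \<kappa>(1)] by (simp add: mult_le_0_iff pos_divide_le_eq)
    qed
    then show "\<forall>i\<in>{1..p}. \<alpha> i * (f i \<kappa> - \<zeta> i * g i \<kappa>) \<le> 0" by blast
    obtain i where i: "i \<in> {1..p}" "f i \<kappa> / g i \<kappa> < \<zeta> i" using le by blast
    then have "\<alpha> i * (f i \<kappa> - \<zeta> i * g i \<kappa>) < 0"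
      using \<alpha>[OF i(1)] assms(4)[OF i(1) \<kappa>(1)] by (simp add: mult_less_0_iff pos_divide_less_eq)
    then show "\<exists>i\<in>{1..p}. \<alpha> i * (f i \<kappa> - \<zeta> i * g i \<kappa>) < 0" using i(1) by blast
  qed simp
  also have "\<dots> \<le> ?F lam"
    using \<alpha> F_lam by (intro sum_mono) (simp add: less_imp_le)
  finally have "?d ?F < 0"
    using gpslep_semideriv_neg[OF assms(8) \<kappa>(1) lam assms(7)] has_d[OF assms(13)] by blast
  \<comment> \<open>Linearity is applied twice, inside each summand and then to the weighted sum, to
    reach the first sum in \<open>dual\<close>.\<close>
  moreover have "?d ?F = (\<Sum>i=1..p. \<alpha> i * (?d (f i) - \<zeta> i * ?d (g i)))"
    using has_d assms(10,11)
    by (intro semideriv_weighted_sum[OF has_d[OF assms(13)]] has_semideriv_diff_cmult) auto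
  \<comment> \<open>Termwise, \<open>\<beta> j * h j \<kappa> \<le> 0\<close> by primal feasibility
    and \<open>0 \<le> \<beta> j * h j lam\<close> by dual feasibility.\<close>
  moreover have "?H \<kappa> \<le> ?H lam"
    using \<beta> H_lam \<kappa>(2) by (intro sum_mono) (meson mult_nonneg_nonpos order_trans)
  then have "?d ?H \<le> 0"
    using gqslep_semideriv_nonpos[OF assms(9) \<kappa>(1) lam assms(7)] has_d[OF assms(14)] by blast
  moreover have "?d ?H = (\<Sum>j=1..q. \<beta> j * ?d (h j))"
    using has_d assms(12) by (intro semideriv_weighted_sum[OF has_d[OF assms(14)]]) auto
  ultimately show False
    using dual by linarith
qed

end
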